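(* Let $k\ne0$. The weight function $\omega(t)=\psi'(t)$ of the functional $\mathcal{V}$ related to the polynomial sequence $\mathcal{P}(h,k,x)$, obtained by the Stieltjes inversion formula, is $$\omega(t)=\psi'(t)=\begin{cases}\dfrac{\sqrt{4k-(t-h)^2}}{2k\pi} & \text{if } h-2\sqrt{k}<t<h+2\sqrt{k}\text{ and } t\ne h,\\[2mm] 0 & \text{otherwise.}\end{cases}$$ The first case arises when $k>0$; when $k<0$ the limit in the inversion formula is zero, so the second case applies.
   Context: $\mathcal{P}(h,k,x)=\{P_n(h,k,x)\}_{n\ge-1}$ is the sequence of polynomials in $x$ defined by $P_{-1}(h,k,x)=0$, $P_0(h,k,x)=1$, and $P_n(h,k,x)=(x+h)P_{n-1}(h,k,x)-kP_{n-2}(h,k,x)$ for $n\ge1$. For $k\ne0$ it is, by Favard's theorem, a sequence of orthogonal polynomials for a moment functional $\mathcal{V}$ on polynomials, with $\mathcal{V}[1]=1$ and $\mathcal{V}[P_mP_n]=0$ for $m\ne n$. The functional is represented as $\mathcal{V}[f]=\int_C f(t)\,d\psi(t)$, where $C$ is a suitable integration interval and $\psi$ is a distribution with $\psi'(t)=\omega(t)$. The Stieltjes inversion formula reads $$\psi(t)-\psi(0)=-\frac1\pi\lim_{y\to0^+}\int_0^t\operatorname{Im}F(x+iy,h,k)\,dx,$$ where $F(z,h,k)=z^{-1}\mu(z^{-1})=\dfrac{z-h-\sqrt{(z-h)^2-4k}}{2k}$ and $\mu(t)=\sum_{n\ge0}\mu_nt^n=\dfrac{1-ht-\sqrt{(1-ht)^2-4kt^2}}{2kt^2}$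 is the generating function the paper gives for the moments $\mu_n=\mathcal{V}[x^n]$. In the case analysis $h$ and $k$ are treated as real.
   Formalization: For k>0, ψ'(t)=ω(t) is claimed only for t≠h, as ψ'(h)=1/(π√k)≠0; since V[x]=-h while μ(t) has t-coefficient +h, ω represents V after the reflection t→-t (V[p]=∫p(-t)ω(t)dt, and μ generates (-1)^n V[x^n]). *)

theory Defs
  imports "HOL-Analysis.Analysis" "HOL-Computational_Algebra.Polynomial"
begin

text \<open>The convention \<open>P\<^sub>-\<^sub>1 = 0\<close> is built into the equation for index 1.\<close>

fun poly_seq :: "real \<Rightarrow> real \<Rightarrow> nat \<Rightarrow> real poly" where
  "poly_seq h k 0 = 1"
| "poly_seq h k (Suc 0) = [:h, 1:]"
| "poly_seq h k (Suc (Suc n)) = [:h, 1:] * poly_seq h k (Suc n) - smult k (poly_seq h k n)"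

definition moment_functional :: "(nat \<Rightarrow> real poly) \<Rightarrow> (real poly \<Rightarrow> real) \<Rightarrow> bool" where
  "moment_functional Q V \<longleftrightarrow>
     (\<forall>p q. V (p + q) = V p + V q) \<and> (\<forall>c p. V (smult c p) = c * V p) \<and>
     V 1 = 1 \<and> (\<forall>m n. m \<noteq> n \<longrightarrow> V (Q m * Q n) = 0)"

text \<open>
  \<open>sqrt_branch a b\<close> is the square root (for \<open>a \<noteq> 0\<close>) of \<open>a\<^sup>2 - b\<close> that is asymptotic to \<open>a\<close> as
  \<open>b / a\<^sup>2\<close> tends to 0.  This is the branch that makes \<open>moment_gf h k t\<close> a power series in \<open>t\<close>
  with constant term 1 and, equivalently, \<open>stieltjes_F h k z\<close> behave like \<open>1 / z\<close> at infinity.  The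
  principal value of \<open>sqrt ((z - h)\<^sup>2 - 4 * k)\<close> has the wrong sign for \<open>Re z < h\<close>.
\<close>

definition sqrt_branch :: "complex \<Rightarrow> complex \<Rightarrow> complex" where
  "sqrt_branch a b = a * csqrt (1 - b / a\<^sup>2)"

lemma sqrt_branch_squared: "a \<noteq> 0 \<Longrightarrow> (sqrt_branch a b)\<^sup>2 = a\<^sup>2 - b"
  by (simp add: sqrt_branch_def power_mult_distrib field_simps)

text \<open>
  Since \<open>P\<^sub>1 = x + h\<close>, the functional \<open>V\<close> orthogonalising \<open>poly_seq h k\<close> has \<open>V x = - h\<close>, whereas
  the coefficient of \<open>t\<close> in \<open>moment_gf h k t\<close> is \<open>h\<close>: with these signs of \<open>h\<close>, \<open>moment_gf h k\<close>
  generates \<open>(-1)\<^sup>n V(x\<^sup>n)\<close>, and \<open>stieltjes_F h k\<close> and \<open>weight h k\<close> belong to \<open>V\<close> reflected at 0.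
\<close>

definition moment_gf :: "real \<Rightarrow> real \<Rightarrow> complex \<Rightarrow> complex" where
  "moment_gf h k t =
     (1 - of_real h * t - sqrt_branch (1 - of_real h * t) (4 * of_real k * t\<^sup>2))
       / (2 * of_real k * t\<^sup>2)"

definition stieltjes_F :: "real \<Rightarrow> real \<Rightarrow> complex \<Rightarrow> complex" where
  "stieltjes_F h k z = inverse z * moment_gf h k (inverse z)"

lemma stieltjes_F_closed_form:
  assumes "z \<noteq> 0"
  shows "stieltjes_F h k z = (z - of_real h - sqrt_branch (z - of_real h) (4 * of_real k)) / (2 * of_real k)"
proof -
  have eq: "1 - of_real h * inverse z = (z - of_real h) / z"
    using assms by (simp add: field_simps)
  have "sqrt_branch ((z - of_real h) / z) (4 * of_real k * (inverse z)\<^sup>2)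
      = sqrt_branch (z - of_real h) (4 * of_real k) / z"
  proof -
    have "4 * of_real k * (inverse z)\<^sup>2 / ((z - of_real h) / z)\<^sup>2
        = 4 * of_real k / (z - of_real h)\<^sup>2"
      using assms by (simp add: power_divide power_inverse)
    then show ?thesis
      unfolding sqrt_branch_def by simp
  qed
  then have "stieltjes_F h k z =
      inverse z * ((z - of_real h) / z - sqrt_branch (z - of_real h) (4 * of_real k) / z)
        / (2 * of_real k * (inverse z)\<^sup>2)"
    unfolding stieltjes_F_def moment_gf_def eq by simp
  moreover have "inverse z * (a / z - s / z) / (c * (inverse z)\<^sup>2) = (a - s) / c"
    for a s c :: complex
    using assms by (cases "c = 0") (simp_all add: divide_simps power2_eq_square)
  ultimately show ?thesis
    by simp
qed

text \<open>The formula determines \<open>\<psi>\<close> up to an additive constant.\<close>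

definition stieltjes_inversion :: "(complex \<Rightarrow> complex) \<Rightarrow> (real \<Rightarrow> real) \<Rightarrow> bool" where
  "stieltjes_inversion G \<psi> \<longleftrightarrow>
     (\<forall>t. ((\<lambda>y. - (1 / pi) * (LBINT x=ereal 0..ereal t. Im (G (Complex x y))))
             \<longlongrightarrow> \<psi> t - \<psi> 0) (at_right 0))"

text \<open>
  For \<open>k > 0\<close> the value 0 at \<open>t = h\<close> is a convention at a single point: there the inverted
  \<open>\<psi>\<close> has the derivative \<open>1 / (pi * sqrt k)\<close>.
\<close>

definition weight :: "real \<Rightarrow> real \<Rightarrow> real \<Rightarrow> real" where
  "weight h k t =
     (if 0 < k \<and> h - 2 * sqrt k < t \<and> t < h + 2 * sqrt k \<and> t \<noteq> h
      then sqrt (4 * k - (t - h)\<^sup>2) / (2 * k * pi) else 0)"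

end

theory Submission
  imports Defs "HOL-Complex_Analysis.Complex_Analysis"
begin

text \<open>
  Put \<open>w = x + \<i> y - h\<close>.  The closed form of \<open>stieltjes_F\<close> reduces the inversion formula to the
  imaginary part of a square root \<open>g\<close> of \<open>q = w\<^sup>2 - 4 k\<close>.  Whatever the branch,
  \<open>\<bar>Im g\<bar> = sqrt ((\<bar>q\<bar> - Re q) / 2)\<close>, which is continuous in \<open>(x, y)\<close> and equals
  \<open>sqrt (max 0 (4 k - (x - h)\<^sup>2))\<close> for \<open>y = 0\<close>; and the branch in use has \<open>Im g \<ge> 0\<close> on the upper
  half plane (\<open>Im_sqrt_branch_nonneg\<close>).  So the integrand of the inversion formula extends
  continuously to the real line and the limit may be taken under the integral
  (\<open>stieltjes_inversion_limit\<close>).  For \<open>k < 0\<close> the limiting integrand vanishes.  The derivative and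
  the integrals of \<open>\<psi>\<close> follow from the fundamental theorem of calculus.

  For the moments, the generating function is analytic at 0 after removing a singularity, and its
  power series \<open>M\<close> solves \<open>M = 1 + h X M + k X\<^sup>2 M\<^sup>2\<close>.  The three-term recurrence turns this equation
  into the statement that \<open>(-1)\<^sup>n\<^sup>+\<^sup>j V (x\<^sup>n P\<^sub>j)\<close> is the coefficient of \<open>X\<^sup>n\<close> in
  \<open>(k X)\<^sup>j M\<^sup>j\<^sup>+\<^sup>1\<close> (\<open>mixed_moments\<close>); the moments are the case \<open>j = 0\<close>.

  For \<open>k > 0\<close>, integration against the reflected weight agrees with \<open>V\<close> on every \<open>P\<^sub>j\<close>, because
  the \<open>P\<^sub>j\<close> are rescaled Chebyshev polynomials of the second kind and the weight is the semicircle
  law (\<open>poly_seq_inverted_density_integral\<close>).  By the recurrence a linear functional is determined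
  by these values (\<open>functional_integral_representation\<close>).
\<close>

section \<open>Boundary behaviour of the Stieltjes transform\<close>

text \<open>
  For \<open>y > 0\<close> this is the absolute value of the imaginary part of either square root of
  \<open>(x + \<i> y - h)\<^sup>2 - 4 k\<close>, written so that continuity up to \<open>y = 0\<close> is evident.
\<close>

definition root_height :: "real \<Rightarrow> real \<Rightarrow> real \<Rightarrow> real \<Rightarrow> real" where
  "root_height h k x y =
     (let q = (Complex (x - h) y)\<^sup>2 - of_real (4 * k) in sqrt ((cmod q - Re q) / 2))"

text \<open>
  The continuous function that the inversion formula produces; it differs from \<open>weight h k\<close> only
  at \<open>t = h\<close>, and only when \<open>k > 0\<close>.
\<close>

definition inverted_density :: "real \<Rightarrow> real \<Rightarrow> real \<Rightarrow> real" where
  "inverted_density h k t = sqrt (max 0 (4 * k - (t - h)\<^sup>2)) / (2 * k * pi)"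

lemma abs_Im_eq_sqrt: "\<bar>Im g\<bar> = sqrt ((cmod (g\<^sup>2) - Re (g\<^sup>2)) / 2)"
proof -
  have "(cmod (g\<^sup>2) - Re (g\<^sup>2)) / 2 = (Im g)\<^sup>2"
    by (simp add: norm_power cmod_power2 Re_power2)
  then show ?thesis
    by (metis real_sqrt_abs)
qed

text \<open>
  Write \<open>g = a * s\<close> with \<open>Re s \<ge> 0\<close>.  Then \<open>Re (g * cnj a) = \<bar>a\<bar>\<^sup>2 * Re s \<ge> 0\<close>, while
  \<open>g\<^sup>2 = a\<^sup>2 - b\<close> with real \<open>b\<close> gives \<open>Re g * Im g = Re a * Im a\<close>.  Multiplying the inequality by a
  negative \<open>Im g\<close> and eliminating \<open>Re g\<close> would give \<open>Im a * ((Re a)\<^sup>2 + (Im g)\<^sup>2) \<le> 0\<close>.  The argument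
  covers both signs of \<open>b\<close> and also the points on the branch cut, which meets the upper half plane
  when \<open>b < 0\<close>.
\<close>

lemma Im_sqrt_branch_nonneg:
  assumes "Im a > 0"
  shows "Im (sqrt_branch a (of_real b)) \<ge> 0"
proof (rule ccontr)
  define s where "s = csqrt (1 - of_real b / a\<^sup>2)"
  define g where "g = sqrt_branch a (of_real b)"
  assume "\<not> Im (sqrt_branch a (of_real b)) \<ge> 0"
  then have neg: "Im g < 0"
    by (simp add: g_def)
  have g: "g = a * s"
    by (simp only: g_def s_def sqrt_branch_def)
  have "a \<noteq> 0"
    using assms by auto
  then have "g\<^sup>2 = a\<^sup>2 - of_real b"
    unfolding g_def by (rule sqrt_branch_squared)
  then have "Im (g\<^sup>2) = Im (a\<^sup>2)"
    by simp
  then have prod: "Re g * Im g = Re a * Im a"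
    by (simp add: Im_power2)
  have "Re g * Re a + Im g * Im a = ((Re a)\<^sup>2 + (Im a)\<^sup>2) * Re s"
    by (simp add: g algebra_simps power2_eq_square)
  moreover have "Re s \<ge> 0"
    unfolding s_def by (rule Re_csqrt)
  ultimately have "Re g * Re a + Im g * Im a \<ge> 0"
    by simp
  with neg have "Im g * (Re g * Re a + Im g * Im a) \<le> 0"
    by (simp add: mult_nonpos_nonneg)
  also have "Im g * (Re g * Re a + Im g * Im a) = (Re g * Im g) * Re a + (Im g)\<^sup>2 * Im a"
    by (simp add: algebra_simps power2_eq_square)
  also have "\<dots> = Im a * ((Re a)\<^sup>2 + (Im g)\<^sup>2)"
    unfolding prod by (simp add: algebra_simps power2_eq_square)
  finally have "(Re a)\<^sup>2 + (Im g)\<^sup>2 \<le> 0"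
    using assms by (simp add: mult_le_0_iff)
  then show False
    using neg by (simp add: sum_power2_le_zero_iff)
qed

lemma Im_sqrt_branch:
  assumes "y > 0"
  shows "Im (sqrt_branch (Complex (x - h) y) (of_real (4 * k))) = root_height h k x y"
proof -
  have "Complex (x - h) y \<noteq> 0"
    using assms by (simp add: complex_eq_iff)
  then have "\<bar>Im (sqrt_branch (Complex (x - h) y) (of_real (4 * k)))\<bar> = root_height h k x y"
    unfolding abs_Im_eq_sqrt root_height_def Let_def by (simp add: sqrt_branch_squared)
  moreover have "Im (sqrt_branch (Complex (x - h) y) (of_real (4 * k))) \<ge> 0"
    using assms by (intro Im_sqrt_branch_nonneg) simp
  ultimately show ?thesis
    by linarith
qed

lemma continuous_root_height: "continuous_on A (\<lambda>(y, x). root_height h k x y)"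
  unfolding root_height_def Let_def case_prod_beta Complex_eq
  by (intro continuous_intros) auto

lemma root_height_0: "root_height h k x 0 = 2 * k * pi * inverted_density h k x" if "k \<noteq> 0"
proof -
  have "(Complex (x - h) 0)\<^sup>2 - of_real (4 * k) = of_real ((x - h)\<^sup>2 - 4 * k)"
    by (simp add: complex_eq_iff power2_eq_square)
  then have "root_height h k x 0 = sqrt ((\<bar>(x - h)\<^sup>2 - 4 * k\<bar> - ((x - h)\<^sup>2 - 4 * k)) / 2)"
    unfolding root_height_def Let_def by (simp only: norm_of_real Re_complex_of_real)
  also have "(\<bar>(x - h)\<^sup>2 - 4 * k\<bar> - ((x - h)\<^sup>2 - 4 * k)) / 2 = max 0 (4 * k - (x - h)\<^sup>2)"
    by (auto simp: max_def)
  finally show ?thesis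
    using that by (simp add: inverted_density_def)
qed

lemma inverted_density_eq_weight: "k \<noteq> 0 \<Longrightarrow> t \<noteq> h \<or> k < 0 \<Longrightarrow> inverted_density h k t = weight h k t"
proof -
  assume "k \<noteq> 0" and t: "t \<noteq> h \<or> k < 0"
  show ?thesis
  proof (cases "0 < k")
    case True
    have "4 * k = (2 * sqrt k)\<^sup>2"
      using True by (simp add: power_mult_distrib)
    then have "(t - h)\<^sup>2 < 4 * k \<longleftrightarrow> \<bar>t - h\<bar> < 2 * sqrt k"
      using True abs_le_square_iff[of "2 * sqrt k" "t - h"] by (simp add: not_le[symmetric])
    moreover have "\<bar>t - h\<bar> < 2 * sqrt k \<longleftrightarrow> h - 2 * sqrt k < t \<and> t < h + 2 * sqrt k"
      by linarith
    ultimately show ?thesis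
      using True t by (auto simp: inverted_density_def weight_def max_def)
  next
    case False
    then have "4 * k - (t - h)\<^sup>2 \<le> 0"
      by (smt (verit) zero_le_power2)
    then show ?thesis
      using False by (simp add: inverted_density_def weight_def max_def)
  qed
qed

lemma continuous_inverted_density: "continuous_on A (inverted_density h k)"
  unfolding inverted_density_def by (cases "k = 0") (auto intro!: continuous_intros)

lemma Im_stieltjes_F:
  assumes "y > 0" "k \<noteq> 0"
  shows "Im (stieltjes_F h k (Complex x y)) = (y - root_height h k x y) / (2 * k)"
proof -
  define g where "g = sqrt_branch (Complex (x - h) y) (of_real (4 * k))"
  have "Complex x y \<noteq> 0"
    using assms by (simp add: complex_eq_iff)
  then have "stieltjes_F h k (Complex x y) = (Complex (x - h) y - g) / of_real (2 * k)"
    by (simp add: stieltjes_F_closed_form g_def Complex_eq algebra_simps)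
  then have "Im (stieltjes_F h k (Complex x y)) = (y - Im g) / (2 * k)"
    by (simp only: Im_divide_of_real) simp
  then show ?thesis
    unfolding g_def Im_sqrt_branch[OF assms(1)] .
qed

section \<open>Passage to the limit in the inversion formula\<close>

text \<open>
  At least one of the two intervals has measure 0; the difference handles both orders of the end points.
\<close>

lemma LBINT_eq_integral_of_continuous:
  fixes f :: "real \<Rightarrow> real"
  assumes "continuous_on UNIV f"
  shows "(LBINT x=ereal 0..ereal t. f x) = integral {0..t} f - integral {t..0} f"
proof -
  have *: "(LBINT x=ereal a..ereal b. f x) = integral {a..b} f" if "a \<le> b" for a b
    using that assms
    by (intro interval_integral_eq_integral borel_integrable_atLeastAtMost')
       (auto intro: continuous_on_subset)
  show ?thesis
  proof (cases "0 \<le> t")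
    case True
    then show ?thesis
      using *[of 0 t] by (cases "t = 0") auto
  next
    case False
    then show ?thesis
      using *[of t 0] by (subst interval_integral_endpoints_reverse) auto
  qed
qed

lemma continuous_on_slice:
  assumes "continuous_on UNIV (\<lambda>(y, x). f y x)"
  shows "continuous_on UNIV (f y)"
proof -
  have "continuous_on UNIV (Pair y)"
    by (intro continuous_intros)
  then show ?thesis
    using continuous_on_compose2[OF assms, of UNIV "Pair y"] by simp
qed

text \<open>
  The integral is continuous in the parameter, so no dominating function has to be exhibited for the
  interchange of limit and integral.
\<close>

lemma LBINT_tendsto_boundary:
  fixes f :: "real \<Rightarrow> real \<Rightarrow> real"
  assumes f: "continuous_on UNIV (\<lambda>(y, x). f y x)"
  shows "((\<lambda>y. LBINT x=ereal 0..ereal t. f y x) \<longlongrightarrow> (LBINT x=ereal 0..ereal t. f 0 x)) (at_right 0)"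
proof -
  have slice: "continuous_on UNIV (f y)" for y
    using continuous_on_slice[OF f] .
  have param: "continuous_on UNIV (\<lambda>y. integral {a..b} (f y))" for a b
    using integral_continuous_on_param[of UNIV a b f] continuous_on_subset[OF f] by auto
  have "continuous_on UNIV (\<lambda>y. LBINT x=ereal 0..ereal t. f y x)"
    unfolding LBINT_eq_integral_of_continuous[OF slice] by (intro continuous_intros param)
  then show ?thesis
    by (simp add: continuous_on_eq_continuous_at isCont_def filterlim_at_split)
qed

lemma stieltjes_inversion_limit:
  assumes "k \<noteq> 0"
  shows "((\<lambda>y. - (1 / pi) * (LBINT x=ereal 0..ereal t. Im (stieltjes_F h k (Complex x y))))
            \<longlongrightarrow> (LBINT x=ereal 0..ereal t. inverted_density h k x)) (at_right 0)"
proof -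
  define f where "f y x = (root_height h k x y - y) / (2 * k * pi)" for y x
  have cont: "continuous_on UNIV (\<lambda>(y, x). f y x)"
    unfolding f_def case_prod_beta using continuous_root_height[of UNIV h k] assms
    by (intro continuous_intros) (auto simp: case_prod_beta)
  have f0: "f 0 x = inverted_density h k x" for x
    using assms by (simp add: f_def root_height_0)
  have "- (1 / pi) * (LBINT x=ereal 0..ereal t. Im (stieltjes_F h k (Complex x y)))
          = (LBINT x=ereal 0..ereal t. f y x)" if "y > 0" for y
  proof -
    have "- (1 / pi) * (LBINT x=ereal 0..ereal t. Im (stieltjes_F h k (Complex x y)))
          = (LBINT x=ereal 0..ereal t. - (1 / pi) * Im (stieltjes_F h k (Complex x y)))"
      by (rule interval_lebesgue_integral_mult_right[symmetric])
    also have "(\<lambda>x. - (1 / pi) * Im (stieltjes_F h k (Complex x y))) = f y"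
      using Im_stieltjes_F[OF that assms] assms by (auto simp: f_def field_simps)
    finally show ?thesis .
  qed
  then have "\<forall>\<^sub>F y in at_right 0. (LBINT x=ereal 0..ereal t. f y x)
      = - (1 / pi) * (LBINT x=ereal 0..ereal t. Im (stieltjes_F h k (Complex x y)))"
    by (simp add: eventually_at_filter)
  with LBINT_tendsto_boundary[OF cont, of t] show ?thesis
    unfolding f0 by (rule Lim_transform_eventually)
qed

lemma LBINT_inverted_density_derivative:
  "((\<lambda>t. LBINT x=ereal 0..ereal t. inverted_density h k x) has_real_derivative inverted_density h k t) (at t)"
proof -
  define r where "r = \<bar>t\<bar> + 1"
  have "((\<lambda>u. LBINT x=ereal 0..ereal u. inverted_density h k x) has_vector_derivative inverted_density h k t)
          (at t within {-r..r})"
    by (rule interval_integral_FTC2) (auto simp: r_def continuous_inverted_density)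
  moreover have "at t within {-r..r} = at t"
    by (rule at_within_interior) (auto simp: r_def)
  ultimately show ?thesis
    by (simp add: has_real_derivative_iff_has_vector_derivative)
qed

lemma stieltjes_inversion_iff:
  assumes "k \<noteq> 0"
  shows "stieltjes_inversion (stieltjes_F h k) \<psi> \<longleftrightarrow>
           (\<forall>t. \<psi> t = \<psi> 0 + (LBINT x=ereal 0..ereal t. inverted_density h k x))"
proof -
  have "((\<lambda>y. - (1 / pi) * (LBINT x=ereal 0..ereal t. Im (stieltjes_F h k (Complex x y))))
            \<longlongrightarrow> L) (at_right 0) \<longleftrightarrow> L = (LBINT x=ereal 0..ereal t. inverted_density h k x)" for t L
    using stieltjes_inversion_limit[OF assms] tendsto_unique[OF trivial_limit_at_right_real]
    by blast
  then show ?thesis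
    unfolding stieltjes_inversion_def by (simp add: algebra_simps)
qed

lemma stieltjes_inversion_derivative:
  assumes "k \<noteq> 0" "stieltjes_inversion (stieltjes_F h k) \<psi>"
  shows "(\<psi> has_real_derivative inverted_density h k t) (at t)"
proof -
  have "\<psi> = (\<lambda>t. \<psi> 0 + (LBINT x=ereal 0..ereal t. inverted_density h k x))"
    using assms stieltjes_inversion_iff by blast
  moreover have "((\<lambda>t. \<psi> 0 + (LBINT x=ereal 0..ereal t. inverted_density h k x))
      has_real_derivative inverted_density h k t) (at t)"
    by (auto intro!: derivative_eq_intros LBINT_inverted_density_derivative)
  ultimately show ?thesis
    by simp
qed

lemma has_integral_weight_iff:
  assumes "k \<noteq> 0"
  shows "((\<lambda>t. f t * inverted_density h k t) has_integral I) A \<longleftrightarrow> ((\<lambda>t. f t * weight h k t) has_integral I) A"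
  by (rule has_integral_spike_finite_eq[of "{h}"]) (auto simp: inverted_density_eq_weight[OF assms])

lemma stieltjes_inversion_has_integral:
  assumes "k \<noteq> 0" "stieltjes_inversion (stieltjes_F h k) \<psi>" "a \<le> b"
  shows "(weight h k has_integral (\<psi> b - \<psi> a)) {a..b}"
proof -
  have "(inverted_density h k has_integral (\<psi> b - \<psi> a)) {a..b}"
    using assms(3) stieltjes_inversion_derivative[OF assms(1,2)]
    by (intro fundamental_theorem_of_calculus)
       (auto simp: has_real_derivative_iff_has_vector_derivative intro: has_vector_derivative_at_within)
  then show ?thesis
    using has_integral_weight_iff[OF assms(1), of "\<lambda>_. 1"] by simp
qed

section \<open>Moment functionals and the generating function of the moments\<close>

locale linear_functional =
  fixes V :: "real poly \<Rightarrow> real"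
  assumes add: "V (p + q) = V p + V q" and smult: "V (smult c p) = c * V p"
begin

lemma zero: "V 0 = 0"
  using smult[of 0 0] by simp

lemma diff: "V (p - q) = V p - V q"
  using add[of p "smult (-1) q"] smult[of "-1" q] by simp

end

lemma moment_functionalD:
  assumes "moment_functional (poly_seq h k) V"
  shows "linear_functional V" "V (poly_seq h k j) = (if j = 0 then 1 else 0)"
proof -
  show "linear_functional V"
    using assms by unfold_locales (auto simp: moment_functional_def)
  show "V (poly_seq h k j) = (if j = 0 then 1 else 0)"
  proof (cases j)
    case (Suc i)
    have "V (poly_seq h k j * poly_seq h k 0) = 0"
      using assms Suc unfolding moment_functional_def by blast
    then show ?thesis
      using Suc by simp
  qed (use assms in \<open>auto simp: moment_functional_def\<close>)
qed

text \<open>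
  The defining recurrence, solved for multiplication by the variable.  It serves twice to determine
  \<open>V\<close> from its values on \<open>poly_seq h k\<close>: for the moments and for the integral representation.
\<close>

lemma X_times_poly_seq:
  "[:0, 1:] * poly_seq h k j =
     poly_seq h k (Suc j) - smult h (poly_seq h k j) + (if j = 0 then 0 else smult k (poly_seq h k (j - 1)))"
proof (cases j)
  case (Suc i)
  have "[:h, 1:] * q = smult h q + [:0, 1:] * q" for q :: "real poly"
    by simp
  then show ?thesis
    by (simp add: Suc)
qed (simp add: one_pCons)

text \<open>
  The expression for \<open>moment_gf\<close> with its numerator rationalised.  This removes the singularity at
  \<open>t = 0\<close>, where \<open>moment_gf\<close> has the default value of a division by 0.
\<close>

definition regular_gf :: "real \<Rightarrow> real \<Rightarrow> complex \<Rightarrow> complex" where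
  "regular_gf h k t = 2 / ((1 - of_real h * t) *
     (1 + csqrt (1 - 4 * of_real k * t\<^sup>2 / (1 - of_real h * t)\<^sup>2)))"

lemma one_plus_csqrt_nonzero: "1 + csqrt z \<noteq> 0"
proof
  assume "1 + csqrt z = 0"
  then have "Re (1 + csqrt z) = 0"
    by simp
  then show False
    using Re_csqrt[of z] by (simp del: csqrt.sel)
qed

lemma eventually_denominator_nonzero: "\<forall>\<^sub>F t in nhds 0. 1 - of_real h * t \<noteq> (0 :: complex)"
proof -
  have "((\<lambda>t. 1 - of_real h * t) \<longlongrightarrow> 1 - of_real h * (0 :: complex)) (nhds 0)"
    by (intro tendsto_intros filterlim_ident)
  then show ?thesis
    by (rule tendsto_imp_eventually_ne) simp
qed

lemma moment_gf_eq_regular_gf: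
  assumes "k \<noteq> 0" "t \<noteq> 0" "1 - of_real h * t \<noteq> 0"
  shows "moment_gf h k t = regular_gf h k t"
proof -
  define a where "a = 1 - of_real h * t"
  define s where "s = csqrt (1 - 4 * of_real k * t\<^sup>2 / a\<^sup>2)"
  have a: "a \<noteq> 0" and s: "1 + s \<noteq> 0"
    using assms one_plus_csqrt_nonzero by (auto simp: a_def s_def)
  have "a\<^sup>2 * s\<^sup>2 = a\<^sup>2 - 4 * of_real k * t\<^sup>2"
    using a by (simp add: s_def field_simps)
  then have "(a - a * s) * (a * (1 + s)) = 2 * (2 * of_real k * t\<^sup>2)"
    by (simp add: algebra_simps power2_eq_square)
  then have "(a - a * s) / (2 * of_real k * t\<^sup>2) = 2 / (a * (1 + s))"
    using a s assms by (simp add: frac_eq_eq)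
  then show ?thesis
    by (simp add: moment_gf_def regular_gf_def sqrt_branch_def flip: a_def s_def)
qed

lemma regular_gf_quadratic:
  assumes "1 - of_real h * t \<noteq> 0"
  shows "regular_gf h k t = 1 + of_real h * (t * regular_gf h k t) + of_real k * (t * regular_gf h k t)\<^sup>2"
proof -
  define a where "a = 1 - of_real h * t"
  define s where "s = csqrt (1 - 4 * of_real k * t\<^sup>2 / a\<^sup>2)"
  define b where "b = a * (1 + s)"
  have a: "a \<noteq> 0" and s: "1 + s \<noteq> 0"
    using assms one_plus_csqrt_nonzero by (auto simp: a_def s_def)
  then have b: "b \<noteq> 0"
    by (simp add: b_def)
  define f where "f = 2 / b"
  have gf: "regular_gf h k t = f"
    by (simp add: regular_gf_def f_def b_def flip: a_def s_def)
  have "a\<^sup>2 * s\<^sup>2 = a\<^sup>2 - 4 * of_real k * t\<^sup>2"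
    using a by (simp add: s_def field_simps)
  then have "2 * a * b = b\<^sup>2 + 4 * of_real k * t\<^sup>2"
    by (simp add: b_def algebra_simps power2_eq_square)
  then have "a * f = 1 + of_real k * (t * f)\<^sup>2"
    using b by (simp add: f_def field_simps power2_eq_square)
  then show ?thesis
    unfolding gf a_def by (simp only: ring_distribs) algebra
qed

lemma regular_gf_has_fps_expansion: "\<exists>M. regular_gf h k has_fps_expansion M"
proof -
  have "regular_gf h k analytic_on {0}"
    unfolding regular_gf_def
    by (intro analytic_intros) (auto simp: one_plus_csqrt_nonzero)
  then show ?thesis
    using analytic_at_imp_has_fps_expansion_0 by blast
qed

lemma regular_gf_fps_quadratic:
  assumes "regular_gf h k has_fps_expansion M"
  shows "M = 1 + fps_const (of_real h) * (fps_X * M) + fps_const (of_real k) * (fps_X * M)\<^sup>2"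
proof -
  have "(\<lambda>t. 1 + of_real h * (t * regular_gf h k t) + of_real k * (t * regular_gf h k t)\<^sup>2) has_fps_expansion
          1 + fps_const (of_real h) * (fps_X * M) + fps_const (of_real k) * (fps_X * M)\<^sup>2"
    using assms by (intro fps_expansion_intros)
  also have "?this \<longleftrightarrow> regular_gf h k has_fps_expansion
          1 + fps_const (of_real h) * (fps_X * M) + fps_const (of_real k) * (fps_X * M)\<^sup>2"
    using eventually_denominator_nonzero[of h]
    by (intro has_fps_expansion_cong refl) (auto elim!: eventually_mono simp: regular_gf_quadratic[symmetric])
  finally show ?thesis
    using assms fps_expansion_unique_complex by blast
qed

text \<open>
  The idea is to compute all mixed moments \<open>V (x\<^sup>n P\<^sub>j)\<close> at once.  By the recurrence for
  \<open>x P\<^sub>j\<close> they satisfy a recurrence in \<open>n\<close> that starts from \<open>V P\<^sub>j = 0\<close> for \<open>j > 0\<close> and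
  \<open>V P\<^sub>0 = 1\<close>.  Multiplying the quadratic equation for \<open>M\<close> by \<open>(k X)\<^sup>j M\<^sup>j\<close> gives exactly
  the same recurrence for the coefficients of \<open>(k X)\<^sup>j M\<^sup>j\<^sup>+\<^sup>1\<close>, up to the sign \<open>(-1)\<^sup>n\<^sup>+\<^sup>j\<close> that reflects
  the variable.
\<close>

lemma mixed_moments:
  fixes M :: "complex fps"
  assumes V: "moment_functional (poly_seq h k) V"
    and M: "M = 1 + fps_const (of_real h) * (fps_X * M) + fps_const (of_real k) * (fps_X * M)\<^sup>2"
  shows "of_real ((-1) ^ (n + j) * V (monom 1 n * poly_seq h k j))
           = fps_nth ((fps_const (of_real k) * fps_X) ^ j * M ^ Suc j) n"
proof (induction n arbitrary: j)
  case 0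
  have "fps_nth M 0 = 1"
    by (subst M) (simp add: power2_eq_square)
  then show ?case
    using moment_functionalD(2)[OF V, of j] by (simp add: monom_0 one_pCons[symmetric] power_mult_distrib fps_nth_power_0)
next
  case (Suc n)
  interpret linear_functional V
    using V by (rule moment_functionalD)
  let ?P = "poly_seq h k"
  define c :: "complex fps" where "c = fps_const (of_real k)"
  define d :: "complex fps" where "d = fps_const (of_real h)"
  define D where "D j = (c * fps_X) ^ j * M ^ Suc j" for j
  define a :: "nat \<Rightarrow> nat \<Rightarrow> complex"
    where "a n j = of_real ((-1) ^ (n + j) * V (monom 1 n * ?P j))" for n j
  have IH: "a n j = fps_nth (D j) n" for j
    using Suc.IH by (simp add: a_def D_def c_def)
  have "monom 1 (Suc n) * ?P j = monom 1 n * ([:0, 1:] * ?P j)"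
    by (simp add: monom_Suc)
  also have "\<dots> = monom 1 n * ?P (Suc j) - smult h (monom 1 n * ?P j)
                   + (if j = 0 then 0 else smult k (monom 1 n * ?P (j - 1)))"
    unfolding X_times_poly_seq by (simp add: algebra_simps)
  finally have V_step: "V (monom 1 (Suc n) * ?P j) = V (monom 1 n * ?P (Suc j)) - h * V (monom 1 n * ?P j)
                   + (if j = 0 then 0 else k * V (monom 1 n * ?P (j - 1)))"
    by (auto simp: add diff smult zero)
  have "a (Suc n) j = a n (Suc j) + of_real h * a n j + (if j = 0 then 0 else of_real k * a n (j - 1))"
    unfolding a_def V_step
    by (cases j) (simp_all add: algebra_simps del: poly_seq.simps)
  moreover have "D j = (if j = 0 then 1 else fps_X * (c * D (j - 1))) + fps_X * (d * D j) + fps_X * D (Suc j)"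
  proof -
    have "D j = (c * fps_X) ^ j * M ^ j * (1 + d * (fps_X * M) + c * (fps_X * M)\<^sup>2)"
      using M by (simp add: D_def c_def d_def mult_ac)
    also have "\<dots> = (c * fps_X) ^ j * M ^ j + fps_X * (d * D j) + fps_X * D (Suc j)"
      by (simp add: D_def algebra_simps power2_eq_square)
    also have "(c * fps_X) ^ j * M ^ j = (if j = 0 then 1 else fps_X * (c * D (j - 1)))"
      by (cases j) (simp_all add: D_def algebra_simps)
    finally show ?thesis .
  qed
  then have "fps_nth (D j) (Suc n) = fps_nth ((if j = 0 then 1 else fps_X * (c * D (j - 1)))
      + fps_X * (d * D j) + fps_X * D (Suc j)) (Suc n)"
    by (rule arg_cong)
  then have "fps_nth (D j) (Suc n) =
      fps_nth (D (Suc j)) n + of_real h * fps_nth (D j) n + (if j = 0 then 0 else of_real k * fps_nth (D (j - 1)) n)"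
    by (simp add: c_def d_def)
  ultimately have "a (Suc n) j = fps_nth (D j) (Suc n)"
    by (cases "j = 0") (simp_all add: IH)
  then show ?case
    unfolding a_def D_def c_def .
qed

lemma moments_sums_moment_gf:
  assumes "k \<noteq> 0" and V: "moment_functional (poly_seq h k) V"
  shows "\<forall>\<^sub>F t in at 0. (\<lambda>n. of_real (V (monom 1 n)) * (- t) ^ n) sums moment_gf h k t"
proof -
  obtain M where M: "regular_gf h k has_fps_expansion M"
    using regular_gf_has_fps_expansion by blast
  have coeff: "fps_nth M n = of_real ((-1) ^ n * V (monom 1 n))" for n
    using mixed_moments[OF V regular_gf_fps_quadratic[OF M], of n 0] by simp
  have "\<forall>\<^sub>F t in nhds 0. ereal (norm (t :: complex)) < fps_conv_radius M"
  proof -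
    have "\<forall>\<^sub>F t in nhds 0. t \<in> eball (0 :: complex) (fps_conv_radius M)"
      using M by (intro eventually_nhds_in_open) (auto simp: has_fps_expansion_def zero_ereal_def)
    then show ?thesis
      by simp
  qed
  moreover have "\<forall>\<^sub>F t in nhds 0. eval_fps M t = regular_gf h k t"
    using M by (simp add: has_fps_expansion_def)
  ultimately have "\<forall>\<^sub>F t in nhds 0. t \<noteq> 0 \<longrightarrow>
      (\<lambda>n. of_real (V (monom 1 n)) * (- t) ^ n) sums moment_gf h k t"
    using eventually_denominator_nonzero[of h]
  proof eventually_elim
    case (elim t)
    have "fps_nth M n * t ^ n = of_real (V (monom 1 n)) * (- t) ^ n" for n
      unfolding coeff power_minus[of t] by simp
    then show ?case
      using sums_eval_fps[OF elim(1)] elim moment_gf_eq_regular_gf[OF assms(1)] by simp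
  qed
  then show ?thesis
    by (simp add: eventually_at_filter)
qed

section \<open>Integral representation for positive k\<close>

text \<open>
  Up to scaling, \<open>P\<^sub>j\<close> is the Chebyshev polynomial of the second kind \<open>U\<^sub>j\<close>, which satisfies
  \<open>sin \<theta> * U\<^sub>j (cos \<theta>) = sin ((j + 1) * \<theta>)\<close>.
\<close>

lemma sin_times_poly_seq:
  assumes "k > 0"
  shows "sin \<theta> * poly (poly_seq h k j) (2 * sqrt k * cos \<theta> - h) = sqrt k ^ j * sin (real (j + 1) * \<theta>)"
  using assms
proof (induction h k j rule: poly_seq.induct)
  case (2 h k)
  then show ?case
    by (simp add: sin_double)
next
  case (3 h k n)
  have "sin (real (Suc (Suc n) + 1) * \<theta>) = 2 * cos \<theta> * sin (real (Suc n + 1) * \<theta>) - sin (real (n + 1) * \<theta>)"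
    using sin_add[of "real (Suc n + 1) * \<theta>" \<theta>] sin_diff[of "real (Suc n + 1) * \<theta>" \<theta>]
    by (simp add: algebra_simps)
  moreover have "sin \<theta> * poly (poly_seq h k (Suc (Suc n))) (2 * sqrt k * cos \<theta> - h)
      = 2 * sqrt k * cos \<theta> * (sin \<theta> * poly (poly_seq h k (Suc n)) (2 * sqrt k * cos \<theta> - h))
        - sqrt k * sqrt k * (sin \<theta> * poly (poly_seq h k n) (2 * sqrt k * cos \<theta> - h))"
    using "3.prems" by (simp add: algebra_simps del: poly_seq.simps(2))
  moreover have factor: "2 * r * c * (r * s * a) - r * r * (s * b) = r * (r * s) * (2 * c * a - b)"
    for r s a b c :: real
    by (simp add: algebra_simps)
  ultimately show ?case
    unfolding "3.IH"(1)[OF "3.prems"] "3.IH"(2)[OF "3.prems"] by (simp only: power_Suc factor)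
qed simp

lemma has_integral_cos_multiple:
  "((\<lambda>\<theta>. cos (real m * \<theta>)) has_integral (if m = 0 then pi else 0)) {0..pi}"
proof (cases "m = 0")
  case True
  then show ?thesis
    using has_integral_const_real[of "1 :: real" 0 pi] by simp
next
  case False
  have "((\<lambda>\<theta>. cos (real m * \<theta>)) has_integral sin (real m * pi) / m - sin (real m * 0) / m) {0..pi}"
    using False
    by (intro fundamental_theorem_of_calculus)
       (auto intro!: derivative_eq_intros simp flip: has_real_derivative_iff_has_vector_derivative)
  then show ?thesis
    using False by simp
qed

lemma inverted_density_cos:
  assumes "k > 0" "\<theta> \<in> {0..pi}"
  shows "inverted_density h k (h - 2 * sqrt k * cos \<theta>) = 2 * sqrt k * sin \<theta> / (2 * k * pi)"
proof -
  have "4 * k - (h - 2 * sqrt k * cos \<theta> - h)\<^sup>2 = 4 * k * (1 - (cos \<theta>)\<^sup>2)"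
    using assms by (simp add: power_mult_distrib algebra_simps)
  also have "\<dots> = (2 * sqrt k * sin \<theta>)\<^sup>2"
    using assms by (simp add: power_mult_distrib sin_squared_eq)
  finally show ?thesis
    using assms by (simp add: inverted_density_def max_def sin_ge_zero)
qed

text \<open>
  Under \<open>t = h - 2 sqrt k cos \<theta>\<close> both the density and \<open>dt\<close> contribute a factor \<open>sin \<theta>\<close>; one of them
  turns the polynomial into \<open>sin ((j + 1) \<theta>)\<close>, so the claim becomes the orthogonality of
  \<open>sin ((j + 1) \<theta>)\<close> and \<open>sin \<theta>\<close> on \<open>{0..pi}\<close>.
\<close>

lemma poly_seq_inverted_density_integral:
  assumes "k > 0"
  shows "((\<lambda>t. poly (poly_seq h k j) (- t) * inverted_density h k t) has_integral (if j = 0 then 1 else 0)) UNIV"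
proof -
  define f where "f t = poly (poly_seq h k j) (- t) * inverted_density h k t" for t
  define g where "g \<theta> = h - 2 * sqrt k * cos \<theta>" for \<theta>
  have f: "continuous_on A f" for A
    unfolding f_def by (intro continuous_intros continuous_inverted_density)
  have "((\<lambda>\<theta>. (2 * sqrt k * sin \<theta>) *\<^sub>R f (g \<theta>)) has_integral integral {g 0..g pi} f) {0..pi}"
  proof (rule has_integral_substitution[where c = "g 0" and d = "g pi"])
    have "\<bar>sqrt k * cos \<theta>\<bar> \<le> sqrt k" for \<theta>
      using assms mult_left_mono[OF abs_cos_le_one[of \<theta>], of "sqrt k"] by (simp add: abs_mult)
    then show "g ` {0..pi} \<subseteq> {g 0..g pi}"
      by (auto simp: g_def abs_le_iff minus_le_iff)
    show "(g has_real_derivative 2 * sqrt k * sin \<theta>) (at \<theta> within {0..pi})" for \<theta>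
      unfolding g_def by (auto intro!: derivative_eq_intros)
  qed (use assms f in \<open>auto simp: g_def\<close>)
  moreover have "(2 * sqrt k * sin \<theta>) *\<^sub>R f (g \<theta>)
      = sqrt k ^ j / pi * (cos (real j * \<theta>) - cos (real (j + 2) * \<theta>))" if "\<theta> \<in> {0..pi}" for \<theta>
  proof -
    have "(2 * sqrt k * sin \<theta>) *\<^sub>R f (g \<theta>)
        = (2 * sqrt k * sin \<theta>) * (2 * sqrt k * sin \<theta> / (2 * k * pi)) * poly (poly_seq h k j) (2 * sqrt k * cos \<theta> - h)"
      using inverted_density_cos[OF assms that, of h] by (simp add: f_def g_def)
    also have "\<dots> = 2 / pi * sin \<theta> * (sin \<theta> * poly (poly_seq h k j) (2 * sqrt k * cos \<theta> - h))"
      using assms by (simp add: field_simps)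
    also have "\<dots> = sqrt k ^ j / pi * (2 * sin \<theta> * sin (real (j + 1) * \<theta>))"
      unfolding sin_times_poly_seq[OF assms] by simp
    also have "2 * sin \<theta> * sin (real (j + 1) * \<theta>) = cos (real j * \<theta>) - cos (real (j + 2) * \<theta>)"
      using cos_add[of "real (j + 1) * \<theta>" \<theta>] cos_diff[of "real (j + 1) * \<theta>" \<theta>]
      by (simp add: algebra_simps)
    finally show ?thesis .
  qed
  ultimately have "((\<lambda>\<theta>. sqrt k ^ j / pi * (cos (real j * \<theta>) - cos (real (j + 2) * \<theta>)))
      has_integral integral {g 0..g pi} f) {0..pi}"
    by (rule has_integral_eq[rotated])
  moreover have "((\<lambda>\<theta>. sqrt k ^ j / pi * (cos (real j * \<theta>) - cos (real (j + 2) * \<theta>)))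
      has_integral sqrt k ^ j / pi * ((if j = 0 then pi else 0) - (if j + 2 = 0 then pi else 0))) {0..pi}"
    by (intro has_integral_mult_right has_integral_diff has_integral_cos_multiple)
  ultimately have "integral {g 0..g pi} f = sqrt k ^ j / pi * ((if j = 0 then pi else 0) - (if j + 2 = 0 then pi else 0))"
    by (rule has_integral_unique)
  also have "\<dots> = (if j = 0 then 1 else 0)"
    by simp
  finally have "(f has_integral (if j = 0 then 1 else 0)) {g 0..g pi}"
    using integrable_continuous_real[OF f] integrable_integral by metis
  moreover have "f t = 0" if "t \<notin> {g 0..g pi}" for t
  proof -
    have "weight h k t = 0" "t \<noteq> h"
      using that assms by (auto simp: weight_def g_def)
    then show ?thesis
      using inverted_density_eq_weight[of k t h] assms by (simp add: f_def)
  qed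
  ultimately have "(f has_integral (if j = 0 then 1 else 0)) UNIV"
    by (rule has_integral_on_superset) auto
  then show ?thesis
    by (simp add: f_def[abs_def])
qed

text \<open>
  The factor \<open>poly_seq h k j\<close> makes the induction on \<open>p\<close> work: multiplying \<open>p\<close> by the variable is
  traded for shifts of \<open>j\<close>, so integrability and the value of the integral follow together from the
  case of constant \<open>p\<close>.  The representation of \<open>V\<close> itself is the case \<open>j = 0\<close>.
\<close>

lemma functional_integral_representation:
  assumes "k > 0" and V: "moment_functional (poly_seq h k) V"
  shows "((\<lambda>t. poly (p * poly_seq h k j) (- t) * inverted_density h k t) has_integral V (p * poly_seq h k j)) UNIV"
proof (induction p arbitrary: j)
  case 0
  interpret linear_functional V
    using V by (rule moment_functionalD)
  show ?case
    by (simp add: zero)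
next
  case (pCons c p)
  interpret linear_functional V
    using V by (rule moment_functionalD)
  let ?P = "poly_seq h k"
  \<comment> \<open>For \<open>j = 0\<close> the vanishing coefficient encodes \<open>P\<^sub>-\<^sub>1 = 0\<close>, whatever \<open>?P (j - 1)\<close> is.\<close>
  have split: "pCons c p * ?P j = smult c (?P j) + p * ?P (Suc j) - smult h (p * ?P j)
      + smult (if j = 0 then 0 else k) (p * ?P (j - 1))"
  proof -
    have "pCons c p * ?P j = smult c (?P j) + p * ([:0, 1:] * ?P j)"
      by simp
    also have "p * ([:0, 1:] * ?P j) = p * ?P (Suc j) - smult h (p * ?P j)
      + smult (if j = 0 then 0 else k) (p * ?P (j - 1))"
      unfolding X_times_poly_seq by (simp add: algebra_simps)
    finally show ?thesis
      by (simp add: algebra_simps)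
  qed
  have base: "((\<lambda>t. poly (?P j) (- t) * inverted_density h k t) has_integral V (?P j)) UNIV"
    using poly_seq_inverted_density_integral[OF assms(1), of h j] moment_functionalD(2)[OF V, of j] by simp
  have "((\<lambda>t. c * (poly (?P j) (- t) * inverted_density h k t) + poly (p * ?P (Suc j)) (- t) * inverted_density h k t
           - h * (poly (p * ?P j) (- t) * inverted_density h k t)
           + (if j = 0 then 0 else k) * (poly (p * ?P (j - 1)) (- t) * inverted_density h k t))
         has_integral c * V (?P j) + V (p * ?P (Suc j)) - h * V (p * ?P j)
           + (if j = 0 then 0 else k) * V (p * ?P (j - 1))) UNIV"
    by (intro has_integral_add has_integral_diff has_integral_mult_right base pCons.IH)
  then show ?case
    unfolding split by (simp add: add diff smult algebra_simps del: poly_seq.simps)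
qed

section \<open>The weight function\<close>

theorem mainTheorem10:
  fixes h k :: real and V :: "real poly \<Rightarrow> real"
  assumes "k \<noteq> 0"
    and "moment_functional (poly_seq h k) V"
  shows
    "(\<exists>\<psi>. stieltjes_inversion (stieltjes_F h k) \<psi>) \<and>
     (\<forall>\<psi>. stieltjes_inversion (stieltjes_F h k) \<psi> \<longrightarrow>
        (\<forall>t. t \<noteq> h \<or> k < 0 \<longrightarrow> (\<psi> has_real_derivative weight h k t) (at t)) \<and>
        (\<forall>a b. a \<le> b \<longrightarrow> (weight h k has_integral (\<psi> b - \<psi> a)) {a..b})) \<and>
     (k < 0 \<longrightarrow>
        (\<forall>t. ((\<lambda>y. - (1 / pi) * (LBINT x=ereal 0..ereal t. Im (stieltjes_F h k (Complex x y))))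
                \<longlongrightarrow> 0) (at_right 0))) \<and>
     (\<forall>\<^sub>F t in at 0. (\<lambda>n. of_real (V (monom 1 n)) * (- t) ^ n) sums moment_gf h k t) \<and>
     (0 < k \<longrightarrow>
        (\<forall>p. ((\<lambda>t. poly p (- t) * weight h k t) has_integral V p) UNIV))"
proof (intro conjI allI impI)
  show "\<exists>\<psi>. stieltjes_inversion (stieltjes_F h k) \<psi>"
    using stieltjes_inversion_iff[OF assms(1), of h "\<lambda>t. LBINT x=ereal 0..ereal t. inverted_density h k x"]
    by (auto simp: zero_ereal_def[symmetric])
next
  fix \<psi> t assume "stieltjes_inversion (stieltjes_F h k) \<psi>" "t \<noteq> h \<or> k < 0"
  then show "(\<psi> has_real_derivative weight h k t) (at t)"
    using stieltjes_inversion_derivative[OF assms(1)] inverted_density_eq_weight[OF assms(1)] by metis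
next
  fix \<psi> and a b :: real assume "stieltjes_inversion (stieltjes_F h k) \<psi>" "a \<le> b"
  then show "(weight h k has_integral (\<psi> b - \<psi> a)) {a..b}"
    by (rule stieltjes_inversion_has_integral[OF assms(1)])
next
  fix t assume "k < 0"
  then have "inverted_density h k x = 0" for x
    using inverted_density_eq_weight[OF assms(1), of x h] by (simp add: weight_def)
  then show "((\<lambda>y. - (1 / pi) * (LBINT x=ereal 0..ereal t. Im (stieltjes_F h k (Complex x y))))
                \<longlongrightarrow> 0) (at_right 0)"
    using stieltjes_inversion_limit[OF assms(1), of t h] by simp
next
  show "\<forall>\<^sub>F t in at 0. (\<lambda>n. of_real (V (monom 1 n)) * (- t) ^ n) sums moment_gf h k t"
    using assms by (rule moments_sums_moment_gf)
next
  fix p assume "0 < k"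
  then show "((\<lambda>t. poly p (- t) * weight h k t) has_integral V p) UNIV"
    using functional_integral_representation[OF _ assms(2), of p 0] has_integral_weight_iff[OF assms(1)]
    by simp
qed

end
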